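(* Let $X=(X_t)_{t\in\mathbb{Z}^+}$ be a discrete-time Markov chain with discrete state space $S$ and transition matrix $P$, such that $N(x)=\{y: P(x,y)>0\}$ is finite for each $x\in S$. Let $f: S \to \mathbb{R}$ be a function. (i) Let $(\alpha_i)_{i \in \mathbb{Z}^+}$ be a sequence of positive constants such that for all $i \in \mathbb{Z}^+$, $$\sup_{x \in S,\, y \in N(x)}|\mathbb{E}_x [f(X_i)]- \mathbb{E}_y [f(X_i)]| \le \alpha_i.$$ Then for all $a > 0$, $x_0 \in S$ and integers $t > 0$, $$\mathbb{P}_{x_0} (|f(X_t)-\mathbb{E}_{x_0} [f(X_t)] |\ge a ) \le 2\exp\Big(-\frac{a^2}{2\sum_{i=0}^{t-1} \alpha_i^2}\Big).$$ (ii) More generally, let $S_0$ be a non-empty subset of $S$, and let $(\alpha_i)_{i \in \mathbb{Z}^+}$ be a sequence of positive constants such that, for all $i\in \mathbb{Z}^+$, $$\sup_{x,y\in S_0:\, y \in N(x)}|\mathbb{E}_x [f(X_i)]-\mathbb{E}_y [f(X_i)]| \le \alpha_i.$$ Let $S_0^0= \{ x \in S_0: N(x) \subseteq S_0\}$. Then for all $x_0 \in S_0^0$, $a >0$ and integers $t >0$, $$\mathbb{P}_{x_0} \Big (\{|f(X_t)-\mathbb{E}_{x_0} [f(X_t)] |\ge a \}\cap \{X_s \in S_0^0 \text{ for all } 0 \le s \le t-1\} \Big )\le 2\exp\Big(-\frac{a^2}{2\sum_{i=0}^{t-1} \alpha_i^2}\Big).$$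
   Context: $\mathbb{Z}^+=\{0,1,2,\dots\}$. $\mathbb{P}_{x}$ and $\mathbb{E}_{x}$ denote the law of the chain, and the corresponding expectation, conditional on $X_0=x$. The chain may be lazy, i.e. $P(x,x)>0$ is allowed. *)

theory Defs
  imports "HOL-Probability.Probability"
begin

locale stochastic_matrix =
  fixes S :: "'s set" and P :: "'s \<Rightarrow> 's \<Rightarrow> real"
  assumes nonneg: "\<And>x y. x \<in> S \<Longrightarrow> y \<in> S \<Longrightarrow> 0 \<le> P x y"
    and row_sum: "\<And>x. x \<in> S \<Longrightarrow> (P x has_sum 1) S"

(* Only the values P x y with x, y in S are meaningful.  The measure Pr x is the law of the chain
   conditional on X 0 = x; a whole family of laws is needed because a single initial distribution
   may give some states probability zero.  Measurability into count_space S means that every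
   set of states is an event, and it forces X t to take values in S. *)
locale markov_chain = stochastic_matrix S P
  for S :: "'s set" and P :: "'s \<Rightarrow> 's \<Rightarrow> real" +
  fixes Pr :: "'s \<Rightarrow> 'w measure" and X :: "nat \<Rightarrow> 'w \<Rightarrow> 's"
  assumes law: "\<And>x. x \<in> S \<Longrightarrow> prob_space (Pr x)"
    and measurable_X: "\<And>x t. x \<in> S \<Longrightarrow> X t \<in> measurable (Pr x) (count_space S)"
    and initial: "\<And>x. x \<in> S \<Longrightarrow> \<P>(\<omega> in Pr x. X 0 \<omega> = x) = 1"
    and markov: "\<And>x n z y. x \<in> S \<Longrightarrow> y \<in> S \<Longrightarrow>
      \<P>(\<omega> in Pr x. \<forall>i\<le>n. X i \<omega> = z i) > 0 \<Longrightarrow>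
      \<P>(\<omega> in Pr x. X (Suc n) \<omega> = y \<bar> \<forall>i\<le>n. X i \<omega> = z i) = P (z n) y"

definition nbrs :: "'s set \<Rightarrow> ('s \<Rightarrow> 's \<Rightarrow> real) \<Rightarrow> 's \<Rightarrow> 's set" where
  "nbrs S P x = {y \<in> S. P x y > 0}"

definition inner_part :: "'s set \<Rightarrow> ('s \<Rightarrow> 's \<Rightarrow> real) \<Rightarrow> 's set \<Rightarrow> 's set" where
  "inner_part S P S0 = {x \<in> S0. nbrs S P x \<subseteq> S0}"

definition expect :: "('s \<Rightarrow> 'w measure) \<Rightarrow> (nat \<Rightarrow> 'w \<Rightarrow> 's) \<Rightarrow> ('s \<Rightarrow> real) \<Rightarrow> 's \<Rightarrow> nat \<Rightarrow> real" where
  "expect Pr X f x i = (\<integral>\<omega>. f (X i \<omega>) \<partial>Pr x)"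

(* The supremum over adjacent pairs in A of the differences of expectations, taken in the
   extended reals so that it is infinity (rather than unspecified) for an unbounded set. *)
definition max_diff :: "'s set \<Rightarrow> ('s \<Rightarrow> 's \<Rightarrow> real) \<Rightarrow> ('s \<Rightarrow> 'w measure) \<Rightarrow> (nat \<Rightarrow> 'w \<Rightarrow> 's) \<Rightarrow>
    ('s \<Rightarrow> real) \<Rightarrow> 's set \<Rightarrow> nat \<Rightarrow> ereal" where
  "max_diff S P Pr X f A i =
    (SUP (x, y) \<in> {(x, y). x \<in> A \<and> y \<in> A \<and> y \<in> nbrs S P x}.
      ereal \<bar>expect Pr X f x i - expect Pr X f y i\<bar>)"

end

theory Submission
  imports Defs
begin

text \<open>
  Averaging over one step of the chain turns \<open>y \<mapsto> E\<^sub>y [f (X\<^sub>i)]\<close> into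
  \<open>x \<mapsto> E\<^sub>x [f (X\<^bsub>i+1\<^esub>)]\<close>, and over the neighbours of an inner state \<open>x\<close> the former
  deviates from its value at \<open>x\<close> by at most \<open>\<alpha>\<^sub>i\<close>.  By Hoeffding's lemma one step of the chain killed
  outside the inner states therefore costs a factor \<open>exp (h\<^sup>2 \<alpha>\<^sub>i\<^sup>2 / 2)\<close> in the exponential moment, so that
  after \<open>t\<close> steps the moment of \<open>exp (h f (X\<^sub>t))\<close> is at most
  \<open>exp (h E\<^sub>x [f (X\<^sub>t)] + h\<^sup>2 \<Sum>\<^sub>i \<alpha>\<^sub>i\<^sup>2 / 2)\<close>; the Chernoff bound concludes.
  The first part is the case where every state is inner.
\<close>

section \<open>Hoeffding's lemma for a finite weighted average\<close>

lemma Hoeffding_finite_sum: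
  fixes p v :: "'a \<Rightarrow> real" and c r :: real
  assumes "finite I" "\<And>i. i \<in> I \<Longrightarrow> 0 \<le> p i" "sum p I = 1" "0 < l"
    and "\<And>i. i \<in> I \<Longrightarrow> \<bar>v i - c\<bar> \<le> r"
  shows "(\<Sum>i\<in>I. p i * exp (l * v i)) \<le> exp (l * (\<Sum>i\<in>I. p i * v i) + l\<^sup>2 * r\<^sup>2 / 2)"
proof -
  define M where "M = point_measure I p"
  define m where "m = (\<Sum>i\<in>I. p i * v i)"
  have int: "integral\<^sup>L M g = (\<Sum>i\<in>I. p i * g i)" for g :: "'a \<Rightarrow> real"
    unfolding M_def using assms by (simp add: lebesgue_integral_point_measure_finite)
  interpret M: prob_space M
  proof
    show "emeasure M (space M) = 1"
      using assms unfolding M_def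
      by (simp add: space_point_measure emeasure_point_measure_finite sum_ennreal)
  qed
  interpret interval_bounded_random_variable M v "c - r" "c + r"
  proof
    show "v \<in> borel_measurable M"
      by (simp add: M_def)
    have "AE i in M. i \<in> space M"
      by simp
    then show "AE i in M. v i \<in> {c - r..c + r}"
    proof eventually_elim
      case (elim i)
      then have "\<bar>v i - c\<bar> \<le> r"
        using assms(5) by (simp add: M_def space_point_measure)
      then show ?case
        by auto
    qed
  qed
  have "ennreal (\<Sum>i\<in>I. p i * exp (l * (v i - m))) = (\<integral>\<^sup>+i. exp (l * (v i - m)) \<partial>M)"
    unfolding int[symmetric] M_def using assms(1)
    by (intro nn_integral_eq_integral[symmetric] integrable_point_measure_finite) auto
  \<comment> \<open>The range is an interval of length 2 r about \<open>c\<close>, which need not be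
    the mean. The usual constant 1/8 therefore turns into
    \<open>l\<^sup>2 * (2 * r)\<^sup>2 / 8\<close>, that is 1/2 in terms of
    \<open>r\<close>.\<close>
  also have "\<dots> \<le> ennreal (exp (l\<^sup>2 * ((c + r) - (c - r))\<^sup>2 / 8))"
    using Hoeffdings_lemma_nn_integral[OF \<open>0 < l\<close>] by (simp add: int m_def)
  also have "l\<^sup>2 * ((c + r) - (c - r))\<^sup>2 / 8 = l\<^sup>2 * r\<^sup>2 / 2"
    by (simp add: power2_eq_square)
  finally have "(\<Sum>i\<in>I. p i * exp (l * (v i - m))) \<le> exp (l\<^sup>2 * r\<^sup>2 / 2)"
    by simp
  then have "exp (l * m) * (\<Sum>i\<in>I. p i * exp (l * (v i - m))) \<le> exp (l * m + l\<^sup>2 * r\<^sup>2 / 2)"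
    by (simp add: exp_add)
  moreover have "exp (l * m) * (p i * exp (l * (v i - m))) = p i * exp (l * v i)" for i
    by (simp add: right_diff_distrib exp_diff)
  ultimately show ?thesis
    by (simp add: sum_distrib_left flip: m_def)
qed

lemma (in stochastic_matrix) sum_nbrs:
  assumes "x \<in> S" "finite (nbrs S P x)"
  shows "(\<Sum>y\<in>nbrs S P x. P x y) = 1"
proof -
  have "P x y = 0" if "y \<in> S - nbrs S P x" for y
    using that nonneg[OF assms(1), of y] by (auto simp: nbrs_def)
  then have "(P x has_sum 1) S \<longleftrightarrow> (P x has_sum 1) (nbrs S P x)"
    by (intro has_sum_cong_neutral) (auto simp: nbrs_def)
  then have "(P x has_sum 1) (nbrs S P x)"
    using row_sum[OF assms(1)] by blast
  then show ?thesis
    using assms(2) by (simp add: has_sum_finite_iff)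
qed

section \<open>Transition operators, reachable states and paths\<close>

locale locally_finite_markov_chain = markov_chain +
  assumes finite_nbrs: "x \<in> S \<Longrightarrow> finite (nbrs S P x)"
begin

text \<open>The indicator tests the state that is left, not the one that is entered. Hence the n-th
  iterate constrains times 0 to n - 1 and leaves time n free, as in the event of the second claim.
  With \<open>A = UNIV\<close> this is the ordinary transition operator.\<close>

definition killed_step :: "'a set \<Rightarrow> ('a \<Rightarrow> real) \<Rightarrow> 'a \<Rightarrow> real" where
  "killed_step A \<phi> x = of_bool (x \<in> A) * (\<Sum>y\<in>nbrs S P x. P x y * \<phi> y)"

text \<open>These finite sets carry the laws of the chain. They make every real function of
  \<open>X n\<close> almost surely bounded, and they leave only finitely many paths to sum over,
  although \<open>S\<close> may be infinite.\<close>

primrec reach :: "'a \<Rightarrow> nat \<Rightarrow> 'a set" where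
  "reach x 0 = {x}"
| "reach x (Suc n) = (\<Union>y\<in>reach x n. nbrs S P y)"

lemma nbrs_subset: "nbrs S P x \<subseteq> S"
  by (auto simp: nbrs_def)

lemma reach_subset: "x \<in> S \<Longrightarrow> reach x n \<subseteq> S"
  using nbrs_subset by (cases n) auto

lemma finite_reach: "x \<in> S \<Longrightarrow> finite (reach x n)"
  using finite_nbrs reach_subset by (induction n) auto

lemma pred_X [measurable]:
  assumes "x \<in> S"
  shows "Measurable.pred (Pr x) (\<lambda>\<omega>. Q (X t \<omega>))"
  using measurable_compose[OF measurable_X[OF assms], of Q "count_space UNIV"] by simp

lemma borel_measurable_X [measurable]:
  fixes \<phi> :: "'a \<Rightarrow> real"
  assumes "x \<in> S"
  shows "(\<lambda>\<omega>. \<phi> (X t \<omega>)) \<in> borel_measurable (Pr x)"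
  using measurable_compose[OF measurable_X[OF assms], of \<phi> borel] by simp

text \<open>Multiplying out the conditional probability removes the requirement that the path have
  positive probability: on a null path both sides vanish.\<close>

lemma prob_path_Suc:
  assumes "x \<in> S" "y \<in> S"
  shows "\<P>(\<omega> in Pr x. (\<forall>i\<le>n. X i \<omega> = z i) \<and> X (Suc n) \<omega> = y) =
    \<P>(\<omega> in Pr x. \<forall>i\<le>n. X i \<omega> = z i) * P (z n) y"
proof -
  interpret prob_space "Pr x"
    by (rule law) fact
  note [measurable] = pred_X[OF assms(1)]
  have le: "\<P>(\<omega> in Pr x. (\<forall>i\<le>n. X i \<omega> = z i) \<and> X (Suc n) \<omega> = y) \<le>
      \<P>(\<omega> in Pr x. \<forall>i\<le>n. X i \<omega> = z i)"
    by (intro finite_measure_mono) auto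
  show ?thesis
  proof (cases "\<P>(\<omega> in Pr x. \<forall>i\<le>n. X i \<omega> = z i) > 0")
    case True
    then show ?thesis
      using markov[OF assms True] by (simp add: cond_prob_def conj_commute field_simps)
  next
    case False
    then have "\<P>(\<omega> in Pr x. \<forall>i\<le>n. X i \<omega> = z i) = 0"
      by (simp add: zero_less_measure_iff)
    then show ?thesis
      using le by (simp add: measure_le_0_iff)
  qed
qed

text \<open>The continuations of a path to the various neighbours are disjoint, and since the row
  sums to 1 over \<open>nbrs S P (z n)\<close>, their probabilities exhaust that of the
  path.\<close>

lemma AE_path_nbrs:
  assumes "x \<in> S" "z n \<in> S"
  shows "AE \<omega> in Pr x. (\<forall>i\<le>n. X i \<omega> = z i) \<longrightarrow> X (Suc n) \<omega> \<in> nbrs S P (z n)"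
proof -
  interpret prob_space "Pr x"
    by (rule law) fact
  note [measurable] = pred_X[OF assms(1)]
  define E where "E = {\<omega>\<in>space (Pr x). \<forall>i\<le>n. X i \<omega> = z i}"
  define F where "F y = {\<omega>\<in>space (Pr x). (\<forall>i\<le>n. X i \<omega> = z i) \<and> X (Suc n) \<omega> = y}" for y
  have sets: "E \<in> events" "\<And>y. F y \<in> events"
    unfolding E_def F_def by measurable
  have "prob (\<Union>y\<in>nbrs S P (z n). F y) = (\<Sum>y\<in>nbrs S P (z n). prob (F y))"
    using sets finite_nbrs[OF assms(2)]
    by (intro finite_measure_finite_Union) (auto simp: disjoint_family_on_def F_def)
  also have "\<dots> = (\<Sum>y\<in>nbrs S P (z n). prob E * P (z n) y)"
    unfolding E_def F_def using assms nbrs_subset by (intro sum.cong refl prob_path_Suc) auto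
  also have "\<dots> = prob E"
    using sum_nbrs[OF assms(2) finite_nbrs[OF assms(2)]] by (simp flip: sum_distrib_left)
  finally have zero: "prob (E - (\<Union>y\<in>nbrs S P (z n). F y)) = 0"
    using sets finite_nbrs[OF assms(2)]
    by (subst finite_measure_Diff) (auto simp: E_def F_def)
  have eq: "{\<omega>\<in>space (Pr x). \<not> ((\<forall>i\<le>n. X i \<omega> = z i) \<longrightarrow> X (Suc n) \<omega> \<in> nbrs S P (z n))} =
      E - (\<Union>y\<in>nbrs S P (z n). F y)"
    by (auto simp: E_def F_def)
  have "E - (\<Union>y\<in>nbrs S P (z n). F y) \<in> events"
    using sets finite_nbrs[OF assms(2)] by auto
  from AE_iff_measurable[OF this eq] zero show ?thesis
    by (simp add: emeasure_eq_measure)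
qed

lemma AE_reach:
  assumes "x \<in> S"
  shows "AE \<omega> in Pr x. \<forall>i\<le>n. X i \<omega> \<in> reach x i"
proof (induction n)
  case 0
  interpret prob_space "Pr x"
    by (rule law) fact
  have "AE \<omega> in Pr x. X 0 \<omega> = x"
    using initial[OF assms] pred_X[OF assms, of "\<lambda>y. y = x" 0]
    by (subst (asm) prob_Collect_eq_1) auto
  then show ?case
    by auto
next
  case (Suc n)
  \<comment> \<open>By induction almost every trajectory follows one of finitely many paths, so the
    exceptional null sets of the single paths can be united.\<close>
  have "AE \<omega> in Pr x. \<forall>z\<in>PiE {..n} (reach x).
      (\<forall>i\<le>n. X i \<omega> = z i) \<longrightarrow> X (Suc n) \<omega> \<in> nbrs S P (z n)"
    using assms reach_subset[OF assms, of n]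
    by (intro AE_finite_allI finite_PiE AE_path_nbrs finite_reach) (auto dest: PiE_mem)
  with Suc show ?case
  proof eventually_elim
    case (elim \<omega>)
    let ?z = "restrict (\<lambda>i. X i \<omega>) {..n}"
    have "?z \<in> PiE {..n} (reach x)"
      using elim(1) by auto
    then have "X (Suc n) \<omega> \<in> nbrs S P (X n \<omega>)"
      using elim(2) by fastforce
    then show ?case
      using elim(1) by (auto simp: le_Suc_eq)
  qed
qed

section \<open>Integrals along the killed chain\<close>

lemma integrable_killed:
  assumes "x \<in> S"
  shows "integrable (Pr x) (\<lambda>\<omega>. of_bool (\<forall>i<n. X i \<omega> \<in> A) * \<phi> (X n \<omega>) :: real)"
proof -
  interpret prob_space "Pr x"
    by (rule law) fact
  note [measurable] = pred_X[OF assms] borel_measurable_X[OF assms]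
  show ?thesis
  proof (rule integrable_const_bound)
    \<comment> \<open>\<open>\<phi>\<close> is arbitrary; the bound comes from the finiteness of
      \<open>reach x n\<close>.\<close>
    show "AE \<omega> in Pr x. norm (of_bool (\<forall>i<n. X i \<omega> \<in> A) * \<phi> (X n \<omega>)) \<le> (\<Sum>y\<in>reach x n. \<bar>\<phi> y\<bar>)"
      using AE_reach[OF assms, of n]
    proof eventually_elim
      case (elim \<omega>)
      then have "\<bar>\<phi> (X n \<omega>)\<bar> \<le> (\<Sum>y\<in>reach x n. \<bar>\<phi> y\<bar>)"
        using finite_reach[OF assms] by (intro member_le_sum) auto
      then show ?case
        by (auto simp: sum_nonneg)
    qed
  qed measurable
qed

text \<open>Almost surely the trajectory agrees up to time n with exactly one member of the finite
  set of paths, so the indicators form a partition of unity. This replaces conditioning on the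
  past.\<close>

lemma expectation_sum_paths:
  assumes "x \<in> S" "integrable (Pr x) g"
  shows "(\<integral>\<omega>. g \<omega> \<partial>Pr x) =
    (\<Sum>z\<in>PiE {..n} (reach x). \<integral>\<omega>. of_bool (\<forall>i\<le>n. X i \<omega> = z i) * g \<omega> \<partial>Pr x :: real)"
proof -
  interpret prob_space "Pr x"
    by (rule law) fact
  note [measurable] = pred_X[OF assms(1)] borel_measurable_integrable[OF assms(2)]
  have fin: "finite (PiE {..n} (reach x))"
    using finite_reach[OF assms(1)] by (intro finite_PiE) auto
  have int: "integrable (Pr x) (\<lambda>\<omega>. of_bool (\<forall>i\<le>n. X i \<omega> = z i) * g \<omega>)" for z
    by (rule Bochner_Integration.integrable_bound[OF assms(2)]) (measurable, auto)
  have "AE \<omega> in Pr x. g \<omega> = (\<Sum>z\<in>PiE {..n} (reach x). of_bool (\<forall>i\<le>n. X i \<omega> = z i) * g \<omega>)"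
    using AE_reach[OF assms(1), of n]
  proof eventually_elim
    case (elim \<omega>)
    let ?z = "restrict (\<lambda>i. X i \<omega>) {..n}"
    have z: "?z \<in> PiE {..n} (reach x)"
      using elim by auto
    \<comment> \<open>Uniqueness needs the functions in \<open>PiE\<close> to be fixed outside
      \<open>{..n}\<close>.\<close>
    have "(\<forall>i\<le>n. X i \<omega> = z i) \<longleftrightarrow> z = ?z" if "z \<in> PiE {..n} (reach x)" for z
      using that by (auto simp: PiE_def extensional_def fun_eq_iff)
    then have "(\<Sum>z\<in>PiE {..n} (reach x). of_bool (\<forall>i\<le>n. X i \<omega> = z i) * g \<omega>) =
        (\<Sum>z\<in>PiE {..n} (reach x). if z = ?z then g \<omega> else 0)"
      by (intro sum.cong) auto
    also have "\<dots> = g \<omega>"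
      using z fin by simp
    finally show ?case
      by simp
  qed
  then have "(\<integral>\<omega>. g \<omega> \<partial>Pr x) =
      (\<integral>\<omega>. (\<Sum>z\<in>PiE {..n} (reach x). of_bool (\<forall>i\<le>n. X i \<omega> = z i) * g \<omega>) \<partial>Pr x)"
    by (intro integral_cong_AE) measurable
  also have "\<dots> = (\<Sum>z\<in>PiE {..n} (reach x). \<integral>\<omega>. of_bool (\<forall>i\<le>n. X i \<omega> = z i) * g \<omega> \<partial>Pr x)"
    using int by (intro Bochner_Integration.integral_sum)
  finally show ?thesis .
qed

text \<open>Both integrals are compared path by path. Along a fixed path up to time n only
  \<open>X (Suc n)\<close> is still random, and \<open>prob_path_Suc\<close> averages
  \<open>\<phi>\<close> over the neighbours of the last state.\<close>

lemma expectation_killed_Suc: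
  assumes "x \<in> S"
  shows "(\<integral>\<omega>. of_bool (\<forall>i<Suc n. X i \<omega> \<in> A) * \<phi> (X (Suc n) \<omega>) \<partial>Pr x) =
    (\<integral>\<omega>. of_bool (\<forall>i<n. X i \<omega> \<in> A) * killed_step A \<phi> (X n \<omega>) \<partial>Pr x)"
proof -
  interpret prob_space "Pr x"
    by (rule law) fact
  note [measurable] = pred_X[OF assms] borel_measurable_X[OF assms]
  have "(\<integral>\<omega>. of_bool (\<forall>i\<le>n. X i \<omega> = z i) *
        (of_bool (\<forall>i<Suc n. X i \<omega> \<in> A) * \<phi> (X (Suc n) \<omega>)) \<partial>Pr x) =
      (\<integral>\<omega>. of_bool (\<forall>i\<le>n. X i \<omega> = z i) *
        (of_bool (\<forall>i<n. X i \<omega> \<in> A) * killed_step A \<phi> (X n \<omega>)) \<partial>Pr x)"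
    (is "?L = ?R") if z: "z \<in> PiE {..n} (reach x)" for z
  proof -
    define E where "E = {\<omega>\<in>space (Pr x). \<forall>i\<le>n. X i \<omega> = z i}"
    define F where "F y = {\<omega>\<in>space (Pr x). (\<forall>i\<le>n. X i \<omega> = z i) \<and> X (Suc n) \<omega> = y}" for y
    have sets [measurable]: "E \<in> events" "\<And>y. F y \<in> events"
      unfolding E_def F_def by measurable
    have zn: "z n \<in> S"
      using z reach_subset[OF assms, of n] by (auto dest: PiE_mem)
    note fin = finite_nbrs[OF zn]
    let ?k = "of_bool (\<forall>i<Suc n. z i \<in> A) :: real"
    have "AE \<omega> in Pr x. of_bool (\<forall>i\<le>n. X i \<omega> = z i) *
        (of_bool (\<forall>i<Suc n. X i \<omega> \<in> A) * \<phi> (X (Suc n) \<omega>)) =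
        (\<Sum>y\<in>nbrs S P (z n). indicator (F y) \<omega> * (?k * \<phi> y))"
      using AE_path_nbrs[OF assms, where z = z and n = n, OF zn] AE_space
    proof eventually_elim
      case (elim \<omega>)
      show ?case
      proof (cases "\<forall>i\<le>n. X i \<omega> = z i")
        case True
        then have "(\<Sum>y\<in>nbrs S P (z n). indicator (F y) \<omega> * (?k * \<phi> y)) =
            (\<Sum>y\<in>nbrs S P (z n). if y = X (Suc n) \<omega> then ?k * \<phi> y else 0)"
          using elim by (intro sum.cong) (auto simp: F_def indicator_def)
        also have "\<dots> = ?k * \<phi> (X (Suc n) \<omega>)"
          using fin elim True by simp
        finally show ?thesis
          using True by (simp add: less_Suc_eq_le)
      next
        case False
        then show ?thesis
          by (auto simp: F_def)
      qed
    qed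
    then have "?L = (\<integral>\<omega>. (\<Sum>y\<in>nbrs S P (z n). indicator (F y) \<omega> * (?k * \<phi> y)) \<partial>Pr x)"
      by (intro integral_cong_AE) measurable
    also have "\<dots> = (\<Sum>y\<in>nbrs S P (z n). prob (F y) * (?k * \<phi> y))"
      by (subst Bochner_Integration.integral_sum) (auto simp: emeasure_eq_measure)
    also have "\<dots> = (\<Sum>y\<in>nbrs S P (z n). (prob E * P (z n) y) * (?k * \<phi> y))"
      unfolding E_def F_def using assms nbrs_subset
      by (intro sum.cong refl arg_cong2[where f = "(*)"] prob_path_Suc) auto
    \<comment> \<open>The constraint at time n is split off from \<open>?k\<close> and becomes the
      indicator inside \<open>killed_step\<close>.\<close>
    also have "\<dots> = prob E * (of_bool (\<forall>i<n. z i \<in> A) * killed_step A \<phi> (z n))"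
      by (auto simp: killed_step_def sum_distrib_left less_Suc_eq mult_ac)
    also have "\<dots> = (\<integral>\<omega>. indicator E \<omega> * (of_bool (\<forall>i<n. z i \<in> A) * killed_step A \<phi> (z n)) \<partial>Pr x)"
      by simp
    also have "\<dots> = ?R"
    proof (intro Bochner_Integration.integral_cong refl)
      fix \<omega> assume "\<omega> \<in> space (Pr x)"
      then show "indicator E \<omega> * (of_bool (\<forall>i<n. z i \<in> A) * killed_step A \<phi> (z n)) =
          of_bool (\<forall>i\<le>n. X i \<omega> = z i) *
          (of_bool (\<forall>i<n. X i \<omega> \<in> A) * killed_step A \<phi> (X n \<omega>))"
        by (cases "\<forall>i\<le>n. X i \<omega> = z i") (simp_all add: E_def)
    qed
    finally show ?thesis .
  qed
  then show ?thesis
    by (simp add: expectation_sum_paths[OF assms integrable_killed[OF assms], of _ _ _ n])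
qed

text \<open>Steps are removed from the end of the path, each replacing \<open>\<phi>\<close> by
  \<open>killed_step A \<phi>\<close>; this is why the induction generalises over
  \<open>\<phi>\<close>.\<close>

lemma expectation_killed:
  assumes "x \<in> S"
  shows "(\<integral>\<omega>. of_bool (\<forall>i<n. X i \<omega> \<in> A) * \<phi> (X n \<omega>) \<partial>Pr x) = (killed_step A ^^ n) \<phi> x"
proof (induction n arbitrary: \<phi>)
  case 0
  interpret prob_space "Pr x"
    by (rule law) fact
  have "(\<integral>\<omega>. \<phi> (X 0 \<omega>) \<partial>Pr x) = (\<integral>\<omega>. \<phi> x \<partial>Pr x)"
    using AE_reach[OF assms, of 0] borel_measurable_X[OF assms]
    by (intro integral_cong_AE) auto
  then show ?case
    by (simp add: prob_space)
next
  case (Suc n)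
  then show ?case
    unfolding expectation_killed_Suc[OF assms] by (simp add: funpow_swap1)
qed

section \<open>Moments and tail bounds\<close>

lemma expect_eq_funpow:
  assumes "x \<in> S"
  shows "expect Pr X f x n = (killed_step UNIV ^^ n) f x"
  using expectation_killed[OF assms, of n UNIV f] by (simp add: expect_def)

text \<open>First-step analysis. The Markov hypothesis extends a path at its end, but a power of an
  operator can also be peeled at the start. This avoids shifting the chain in time and relates the
  different laws \<open>Pr x\<close> and \<open>Pr y\<close>.\<close>

lemma expect_Suc:
  assumes "x \<in> S"
  shows "expect Pr X f x (Suc n) = (\<Sum>y\<in>nbrs S P x. P x y * expect Pr X f y n)"
proof -
  have "(\<Sum>y\<in>nbrs S P x. P x y * expect Pr X f y n) =
      (\<Sum>y\<in>nbrs S P x. P x y * (killed_step UNIV ^^ n) f y)"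
    using nbrs_subset by (intro sum.cong refl) (metis expect_eq_funpow subsetD)
  then show ?thesis
    by (simp add: expect_eq_funpow assms killed_step_def)
qed

text \<open>The centring uses the expectation of the unkilled chain. This is harmless: from a state
  in \<open>A\<close> the first step of both chains is the same, and from any other state the left
  side is 0.\<close>

lemma exp_moment_killed:
  assumes "0 < h" "x \<in> S"
    and diff: "\<And>i x y. x \<in> A \<Longrightarrow> y \<in> nbrs S P x \<Longrightarrow>
      \<bar>expect Pr X f y i - expect Pr X f x i\<bar> \<le> \<alpha> i"
  shows "(killed_step A ^^ n) (\<lambda>y. exp (h * f y)) x \<le>
    exp (h * expect Pr X f x n + h\<^sup>2 * (\<Sum>i<n. (\<alpha> i)\<^sup>2) / 2)"
  using assms(2)
proof (induction n arbitrary: x)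
  case 0
  then show ?case
    by (simp add: expect_eq_funpow)
next
  case (Suc n)
  let ?g = "\<lambda>x i. expect Pr X f x i"
  let ?s = "h\<^sup>2 * (\<Sum>i<n. (\<alpha> i)\<^sup>2) / 2"
  show ?case
  proof (cases "x \<in> A")
    case True
    have P: "y \<in> S" "0 \<le> P x y" if "y \<in> nbrs S P x" for y
      using that by (auto simp: nbrs_def)
    have "(killed_step A ^^ Suc n) (\<lambda>y. exp (h * f y)) x =
        (\<Sum>y\<in>nbrs S P x. P x y * (killed_step A ^^ n) (\<lambda>y. exp (h * f y)) y)"
      using True by (simp add: killed_step_def)
    also have "\<dots> \<le> (\<Sum>y\<in>nbrs S P x. P x y * exp (h * ?g y n + ?s))"
      using P by (intro sum_mono mult_left_mono Suc.IH)
    also have "\<dots> = (\<Sum>y\<in>nbrs S P x. P x y * exp (h * ?g y n)) * exp ?s"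
      by (simp add: exp_add sum_distrib_right mult_ac)
    \<comment> \<open>The interval is centred at \<open>?g x n\<close>, the value to which
      \<open>diff\<close> compares the neighbours, whereas the mean over the neighbours is
      \<open>?g x (Suc n)\<close>. The first of n + 1 steps costs \<alpha> at index n because n
      steps remain after it.\<close>
    also have "\<dots> \<le> exp (h * (\<Sum>y\<in>nbrs S P x. P x y * ?g y n) + h\<^sup>2 * (\<alpha> n)\<^sup>2 / 2) * exp ?s"
      using P diff[OF True] \<open>0 < h\<close> finite_nbrs[OF Suc.prems] sum_nbrs[OF Suc.prems]
      by (intro mult_right_mono Hoeffding_finite_sum[where c = "?g x n"]) auto
    also have "\<dots> = exp (h * ?g x (Suc n) + h\<^sup>2 * (\<Sum>i<Suc n. (\<alpha> i)\<^sup>2) / 2)"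
      by (simp add: expect_Suc[OF Suc.prems] algebra_simps add_divide_distrib flip: exp_add)
    finally show ?thesis .
  next
    case False
    then show ?thesis
      by (simp add: killed_step_def)
  qed
qed

lemma upper_tail_killed:
  assumes "x \<in> S" "0 < a" "0 < \<sigma>" and \<sigma>: "\<sigma> = (\<Sum>i<n. (\<alpha> i)\<^sup>2)"
    and diff: "\<And>i x y. x \<in> A \<Longrightarrow> y \<in> nbrs S P x \<Longrightarrow>
      \<bar>expect Pr X f y i - expect Pr X f x i\<bar> \<le> \<alpha> i"
  shows "\<P>(\<omega> in Pr x. f (X n \<omega>) - expect Pr X f x n \<ge> a \<and> (\<forall>i<n. X i \<omega> \<in> A))
    \<le> exp (- (a\<^sup>2 / (2 * \<sigma>)))" (is "measure _ ?E \<le> _")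
proof -
  interpret prob_space "Pr x"
    by (rule law) fact
  note [measurable] = pred_X[OF assms(1)] borel_measurable_X[OF assms(1)]
  \<comment> \<open>This choice minimises the final exponent
    \<open>h\<^sup>2 * \<sigma> / 2 - h * a\<close>.\<close>
  define h where "h = a / \<sigma>"
  define m where "m = expect Pr X f x n"
  have "0 < h"
    using assms by (simp add: h_def)
  let ?k = "\<lambda>\<omega>. of_bool (\<forall>i<n. X i \<omega> \<in> A) * exp (h * f (X n \<omega>)) :: real"
  have sets [measurable]: "?E \<in> events"
    by measurable
  have "measure (Pr x) ?E = (\<integral>\<omega>. indicator ?E \<omega> \<partial>Pr x)"
    by simp
  also have "\<dots> \<le> (\<integral>\<omega>. exp (- h * (m + a)) * ?k \<omega> \<partial>Pr x)"
  proof (rule integral_mono)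
    show "integrable (Pr x) (indicator ?E :: _ \<Rightarrow> real)"
      by (simp add: emeasure_eq_measure)
    show "integrable (Pr x) (\<lambda>\<omega>. exp (- h * (m + a)) * ?k \<omega>)"
      using integrable_killed[OF assms(1)] by (rule integrable_mult_right)
    fix \<omega> assume "\<omega> \<in> space (Pr x)"
    \<comment> \<open>The pointwise form of the Chernoff bound, with the path indicator kept as a
      factor on both sides.\<close>
    have "1 \<le> exp (- h * (m + a)) * exp (h * f (X n \<omega>))" if "f (X n \<omega>) - m \<ge> a"
    proof -
      have "0 \<le> h * (f (X n \<omega>) - m - a)"
        using that \<open>0 < h\<close> by simp
      then show ?thesis
        by (simp add: algebra_simps flip: exp_add)
    qed
    then show "indicator ?E \<omega> \<le> exp (- h * (m + a)) * ?k \<omega>"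
      by (auto simp: indicator_def m_def)
  qed
  also have "\<dots> = exp (- h * (m + a)) * (killed_step A ^^ n) (\<lambda>y. exp (h * f y)) x"
    by (simp add: expectation_killed[OF assms(1), of _ _ "\<lambda>y. exp (h * f y)"])
  also have "\<dots> \<le> exp (- h * (m + a)) * exp (h * m + h\<^sup>2 * \<sigma> / 2)"
    unfolding m_def \<sigma> using exp_moment_killed[OF \<open>0 < h\<close> assms(1) diff] by (intro mult_left_mono) auto
  also have "\<dots> = exp (h\<^sup>2 * \<sigma> / 2 - h * a)"
    by (simp add: algebra_simps flip: exp_add)
  also have "h\<^sup>2 * \<sigma> / 2 - h * a = - (a\<^sup>2 / (2 * \<sigma>))"
    using \<open>0 < \<sigma>\<close> by (simp add: h_def field_simps power2_eq_square)
  finally show ?thesis .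
qed

text \<open>The lower tail is the upper tail of the negated function, which satisfies the same
  hypothesis; the union bound yields the factor 2.\<close>

lemma two_sided_tail_killed:
  assumes "x \<in> S" "0 < a" "0 < \<sigma>" "\<sigma> = (\<Sum>i<n. (\<alpha> i)\<^sup>2)"
    and diff: "\<And>i x y. x \<in> A \<Longrightarrow> y \<in> nbrs S P x \<Longrightarrow>
      \<bar>expect Pr X f y i - expect Pr X f x i\<bar> \<le> \<alpha> i"
  shows "\<P>(\<omega> in Pr x. \<bar>f (X n \<omega>) - expect Pr X f x n\<bar> \<ge> a \<and> (\<forall>i<n. X i \<omega> \<in> A))
    \<le> 2 * exp (- (a\<^sup>2 / (2 * \<sigma>)))"
proof -
  interpret prob_space "Pr x"
    by (rule law) fact
  note [measurable] = pred_X[OF assms(1)] borel_measurable_X[OF assms(1)]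
  define E where "E f = {\<omega>\<in>space (Pr x). f (X n \<omega>) - expect Pr X f x n \<ge> a \<and> (\<forall>i<n. X i \<omega> \<in> A)}" for f
  have sets: "E f \<in> events" for f
    unfolding E_def by measurable
  have neg: "expect Pr X (\<lambda>y. - f y) y i = - expect Pr X f y i" for y i
    by (simp add: expect_def)
  have eq: "{\<omega>\<in>space (Pr x). \<bar>f (X n \<omega>) - expect Pr X f x n\<bar> \<ge> a \<and> (\<forall>i<n. X i \<omega> \<in> A)} =
      E f \<union> E (\<lambda>y. - f y)"
    by (auto simp: E_def neg)
  have "prob (E f \<union> E (\<lambda>y. - f y)) \<le> prob (E f) + prob (E (\<lambda>y. - f y))"
    using sets by (intro measure_subadditive) (auto simp: emeasure_eq_measure)
  also have "\<dots> \<le> exp (- (a\<^sup>2 / (2 * \<sigma>))) + exp (- (a\<^sup>2 / (2 * \<sigma>)))"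
    unfolding E_def
    by (intro add_mono upper_tail_killed[where \<alpha> = \<alpha>] assms)
      (use diff in \<open>simp_all add: neg abs_minus_commute\<close>)
  finally show ?thesis
    unfolding eq by simp
qed

text \<open>Killing outside the inner part, rather than outside \<open>S0\<close>, ensures that
  every neighbour of a surviving state lies in \<open>S0\<close>, so that the pair is covered by the
  supremum. The neighbour itself need not be inner.\<close>

lemma tail_inner_part:
  assumes "S0 \<subseteq> S" and \<alpha>: "\<And>i. 0 < \<alpha> i" "\<And>i. max_diff S P Pr X f S0 i \<le> ereal (\<alpha> i)"
    and "x \<in> S" "0 < a" "0 < t"
  shows "\<P>(\<omega> in Pr x. \<bar>f (X t \<omega>) - expect Pr X f x t\<bar> \<ge> a \<and>
      (\<forall>s\<in>{0..t-1}. X s \<omega> \<in> inner_part S P S0))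
    \<le> 2 * exp (- (a\<^sup>2 / (2 * (\<Sum>i=0..t-1. (\<alpha> i)\<^sup>2))))"
proof -
  \<comment> \<open>The subtraction is truncated, so this needs t to be positive.\<close>
  have t: "{0..t-1} = {..<t}"
    using \<open>0 < t\<close> by auto
  have "\<bar>expect Pr X f y i - expect Pr X f x i\<bar> \<le> \<alpha> i"
    if "x \<in> inner_part S P S0" "y \<in> nbrs S P x" for i x y
  proof -
    have "(x, y) \<in> {(x, y). x \<in> S0 \<and> y \<in> S0 \<and> y \<in> nbrs S P x}"
      using that by (auto simp: inner_part_def)
    then have "ereal \<bar>expect Pr X f x i - expect Pr X f y i\<bar> \<le> max_diff S P Pr X f S0 i"
      unfolding max_diff_def by (rule SUP_upper2) simp
    then have "ereal \<bar>expect Pr X f x i - expect Pr X f y i\<bar> \<le> ereal (\<alpha> i)"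
      using \<alpha>(2) by (rule order_trans)
    then show ?thesis
      by (simp add: abs_minus_commute)
  qed
  moreover have "0 < (\<Sum>i<t. (\<alpha> i)\<^sup>2)"
    using \<alpha>(1) \<open>0 < t\<close> by (intro sum_pos) (auto simp: less_imp_neq[THEN not_sym])
  ultimately show ?thesis
    using two_sided_tail_killed[OF assms(4,5) _ refl, of \<alpha> t "inner_part S P S0" f]
    unfolding t by (simp add: Ball_def)
qed

end

theorem theorem2p1:
  fixes S :: "'s set" and P :: "'s \<Rightarrow> 's \<Rightarrow> real"
    and Pr :: "'s \<Rightarrow> 'w measure" and X :: "nat \<Rightarrow> 'w \<Rightarrow> 's"
    and f :: "'s \<Rightarrow> real"
  assumes "markov_chain S P Pr X"
    and "\<And>x. x \<in> S \<Longrightarrow> finite (nbrs S P x)"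
  shows "(\<forall>\<alpha> :: nat \<Rightarrow> real.
      (\<forall>i. 0 < \<alpha> i) \<and> (\<forall>i. max_diff S P Pr X f S i \<le> ereal (\<alpha> i)) \<longrightarrow>
      (\<forall>a>0. \<forall>x0\<in>S. \<forall>t>0.
        \<P>(\<omega> in Pr x0. \<bar>f (X t \<omega>) - expect Pr X f x0 t\<bar> \<ge> a)
          \<le> 2 * exp (- (a\<^sup>2 / (2 * (\<Sum>i=0..t-1. (\<alpha> i)\<^sup>2))))))
    \<and>
    (\<forall>S0 (\<alpha> :: nat \<Rightarrow> real).
      S0 \<noteq> {} \<and> S0 \<subseteq> S \<and>
      (\<forall>i. 0 < \<alpha> i) \<and> (\<forall>i. max_diff S P Pr X f S0 i \<le> ereal (\<alpha> i)) \<longrightarrow>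
      (\<forall>x0\<in>inner_part S P S0. \<forall>a>0. \<forall>t>0.
        \<P>(\<omega> in Pr x0. \<bar>f (X t \<omega>) - expect Pr X f x0 t\<bar> \<ge> a \<and>
             (\<forall>s\<in>{0..t-1}. X s \<omega> \<in> inner_part S P S0))
          \<le> 2 * exp (- (a\<^sup>2 / (2 * (\<Sum>i=0..t-1. (\<alpha> i)\<^sup>2))))))"
proof -
  interpret locally_finite_markov_chain S P Pr X
    by (intro locally_finite_markov_chain.intro locally_finite_markov_chain_axioms.intro assms)
  have "inner_part S P S = S"
    using nbrs_subset by (auto simp: inner_part_def)
  \<comment> \<open>\<open>X s\<close> maps the whole of \<open>space (Pr x)\<close> into
    \<open>S\<close>, so for \<open>S0 = S\<close> the path constraint holds at every point and the
    two events coincide as sets.\<close>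
  then have inner: "{\<omega>\<in>space (Pr x). Q \<omega> \<and> (\<forall>s\<in>{0..t-1}. X s \<omega> \<in> inner_part S P S)} =
      {\<omega>\<in>space (Pr x). Q \<omega>}" if "x \<in> S" for x Q and t :: nat
    using measurable_space[OF measurable_X[OF that]] by auto
  have mem: "x \<in> S" if "S0 \<subseteq> S" "x \<in> inner_part S P S0" for S0 x
    using that by (auto simp: inner_part_def)
  show ?thesis
  proof (intro conjI allI ballI impI; (elim conjE)?)
    fix \<alpha> :: "nat \<Rightarrow> real" and a :: real and x0 and t :: nat
    assume "\<forall>i. 0 < \<alpha> i" "\<forall>i. max_diff S P Pr X f S i \<le> ereal (\<alpha> i)" "0 < a" "x0 \<in> S" "0 < t"
    then show "\<P>(\<omega> in Pr x0. \<bar>f (X t \<omega>) - expect Pr X f x0 t\<bar> \<ge> a)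
        \<le> 2 * exp (- (a\<^sup>2 / (2 * (\<Sum>i=0..t-1. (\<alpha> i)\<^sup>2))))"
      using tail_inner_part[of S \<alpha> f x0 a t] unfolding inner[OF \<open>x0 \<in> S\<close>] by simp
  qed (rule tail_inner_part; use mem in blast)
qed

end
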